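(* Let $\mathbb{F}$ be a field, let $n\ge 1$, and let $(S_1,m_1),\dots,(S_n,m_n)$ be nonempty finite multisets of elements of $\mathbb{F}$, of sizes $d_1,\dots,d_n$. Let $S=S_1\times\cdots\times S_n$, let $I=I(S)=\bigcap_{\mathbf{s}\in S} I(\mathbf{s},m(\mathbf{s}))$, and let $g_i(x_i)=\prod_{s\in S_i}(x_i-s)^{m_i(s)}\in\mathbb{F}[x_1,\dots,x_n]$ for $i=1,\dots,n$. Then the ideal of $\mathbb{F}[x_1,\dots,x_n]$ generated by $g_1,\dots,g_n$ satisfies $$(g_1(x_1),\dots,g_n(x_n))=I.$$ Moreover, for every polynomial $f\in\mathbb{F}[x_1,\dots,x_n]$ there are polynomials $h_1,\dots,h_n,r\in\mathbb{F}[x_1,\dots,x_n]$ such that $\deg h_i\le \deg f-d_i$ for every $i$, the degree of $r$ in the variable $x_i$ is less than $d_i$ for every $i$, and $$f(\mathbf{x})=r(\mathbf{x})+\sum_{i=1}^n h_i(\mathbf{x})g_i(x_i).$$ In this expansion $r$ is uniquely determined by $f$.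
   Context: A finite multiset $(S_i,m_i)$ of elements of $\mathbb{F}$ is a finite subset $S_i\subseteq\mathbb{F}$ together with a positive integer multiplicity $m_i(s)$ for each $s\in S_i$; it is nonempty if $S_i\neq\emptyset$. Its size is $d_i=\sum_{s\in S_i}m_i(s)$. For $\mathbf{s}=(s_1,\dots,s_n)\in S=S_1\times\cdots\times S_n$ put $m(\mathbf{s})=(m_1(s_1),\dots,m_n(s_n))$. $\mathbb{N}$ is the set of nonnegative integers. For $\mathbf{s}\in\mathbb{F}^n$ and $\mathbf{u}\in\mathbb{N}^n$, $(\mathbf{x}-\mathbf{s})^{\mathbf{u}}=\prod_{i=1}^n(x_i-s_i)^{u_i}$. Every $f\in\mathbb{F}[x_1,\dots,x_n]$ has a unique expansion $f(\mathbf{x})=\sum_{\mathbf{u}\in\mathbb{N}^n}f_{\mathbf{u}}(\mathbf{s})(\mathbf{x}-\mathbf{s})^{\mathbf{u}}$ with $f_{\mathbf{u}}(\mathbf{s})\in\mathbb{F}$. For a vector $\mathbf{w}$ of positive integers, $I(\mathbf{s},\mathbf{w})$ is the ideal of all $f$ with $f_{\mathbf{u}}(\mathbf{s})=0$ for all $\mathbf{u}<\mathbf{w}$, where $\mathbf{u}<\mathbf{w}$ means $u_i<w_i$ for every $i$. $\deg$ denotes total degree; the zero polynomial is regarded as having degree $-\infty$ (so $h_i=0$ if $\deg f<d_i$). *)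

theory Defs
  imports "HOL-Library.Poly_Mapping" "HOL-Library.Multiset" "HOL-Library.Extended_Real"
begin

text \<open>
  Polynomials over \<open>'a\<close> in the variables \<open>x\<^sub>i\<close>, \<open>i :: 'n\<close>, where the finite type
  \<open>'n\<close> has \<open>n\<close> elements (so \<open>n \<ge> 1\<close>).
  Exponent vectors are finitely supported maps from \<open>'n\<close> to \<open>nat\<close>, which for finite
  \<open>'n\<close> is no restriction.
\<close>

type_synonym ('n, 'a) mpoly = "('n \<Rightarrow>\<^sub>0 nat) \<Rightarrow>\<^sub>0 'a"

definition const :: "'a::zero \<Rightarrow> ('n, 'a) mpoly"
  where "const a = Poly_Mapping.single 0 a"

definition var :: "'n \<Rightarrow> ('n, 'a::zero_neq_one) mpoly"
  where "var i = Poly_Mapping.single (Poly_Mapping.single i 1) 1"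

text \<open>Over the empty support the supremum is \<open>-\<infinity>\<close>, the degree of the zero polynomial.\<close>

definition total_degree :: "('n::finite, 'a::zero) mpoly \<Rightarrow> ereal"
  where "total_degree p = (SUP u\<in>Poly_Mapping.keys p. ereal (real (\<Sum>i\<in>UNIV. Poly_Mapping.lookup u i)))"

definition degree_in :: "'n \<Rightarrow> ('n, 'a::zero) mpoly \<Rightarrow> ereal"
  where "degree_in i p = (SUP u\<in>Poly_Mapping.keys p. ereal (real (Poly_Mapping.lookup u i)))"

definition shifted_monom ::
    "('n::finite \<Rightarrow> 'a::comm_ring_1) \<Rightarrow> ('n \<Rightarrow>\<^sub>0 nat) \<Rightarrow> ('n, 'a) mpoly"
  where "shifted_monom s u = (\<Prod>i\<in>UNIV. (var i - const (s i)) ^ Poly_Mapping.lookup u i)"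

definition shifted_sum ::
    "('n::finite \<Rightarrow> 'a::comm_ring_1) \<Rightarrow> (('n \<Rightarrow>\<^sub>0 nat) \<Rightarrow>\<^sub>0 'a) \<Rightarrow> ('n, 'a) mpoly"
  where "shifted_sum s c = (\<Sum>u\<in>Poly_Mapping.keys c. const (Poly_Mapping.lookup c u) * shifted_monom s u)"

text \<open>
  The family of coefficients of \<open>f\<close> in its expansion around \<open>s\<close>;
  lemma \<open>ex1_expansion\<close> below shows that the description is proper.
\<close>

definition expansion ::
    "('n::finite \<Rightarrow> 'a::comm_ring_1) \<Rightarrow> ('n, 'a) mpoly \<Rightarrow> ('n \<Rightarrow>\<^sub>0 nat) \<Rightarrow>\<^sub>0 'a"
  where "expansion s f = (THE c. f = shifted_sum s c)"

definition point_ideal ::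
    "('n::finite \<Rightarrow> 'a::comm_ring_1) \<Rightarrow> ('n \<Rightarrow> nat) \<Rightarrow> ('n, 'a) mpoly set"
  where "point_ideal s w =
    {f. \<forall>u. (\<forall>i. Poly_Mapping.lookup u i < w i) \<longrightarrow> Poly_Mapping.lookup (expansion s f) u = 0}"

text \<open>
  A finite multiset \<open>(S\<^sub>i, m\<^sub>i)\<close> is \<open>M i :: 'a multiset\<close>, with \<open>S\<^sub>i = set_mset (M i)\<close>,
  \<open>m\<^sub>i = count (M i)\<close> and \<open>d\<^sub>i = size (M i)\<close>.
\<close>

definition grid :: "('n \<Rightarrow> 'a multiset) \<Rightarrow> ('n \<Rightarrow> 'a) set"
  where "grid M = {s. \<forall>i. s i \<in> set_mset (M i)}"

definition grid_ideal :: "('n::finite \<Rightarrow> 'a::comm_ring_1 multiset) \<Rightarrow> ('n, 'a) mpoly set"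
  where "grid_ideal M = (\<Inter>s\<in>grid M. point_ideal s (\<lambda>i. count (M i) (s i)))"

definition grid_poly :: "('n \<Rightarrow> 'a::comm_ring_1 multiset) \<Rightarrow> 'n \<Rightarrow> ('n, 'a) mpoly"
  where "grid_poly M i = (\<Prod>s\<in>set_mset (M i). (var i - const s) ^ count (M i) s)"

text \<open>Ideals of a commutative ring are its submodules as a module over itself.\<close>

lemma module_times: "module ((*) :: 'a::comm_ring_1 \<Rightarrow> 'a \<Rightarrow> 'a)"
  by unfold_locales (simp_all add: algebra_simps)

abbreviation ideal_generated :: "'a::comm_ring_1 set \<Rightarrow> 'a set"
  where "ideal_generated \<equiv> module.span (*)"

text \<open>Existence and uniqueness of the expansion around a point.\<close>

lemma shifted_sum_superset:
  assumes "finite A" "Poly_Mapping.keys c \<subseteq> A"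
  shows "shifted_sum s c = (\<Sum>u\<in>A. const (Poly_Mapping.lookup c u) * shifted_monom s u)"
  unfolding shifted_sum_def
  by (rule sum.mono_neutral_left) (use assms in \<open>auto simp: const_def in_keys_iff\<close>)

lemma const_add: "const (a + b) = const a + const b"
  by (simp add: const_def single_add)

lemma const_mult: "const (a * b) = const a * const b"
  by (simp add: const_def mult_single)

lemma const_0 [simp]: "const 0 = 0"
  by (simp add: const_def)

lemma const_1 [simp]: "const 1 = 1"
  by (simp add: const_def)

lemma shifted_sum_0 [simp]: "shifted_sum s 0 = 0"
  by (simp add: shifted_sum_def)

lemma shifted_sum_single:
  "shifted_sum s (Poly_Mapping.single u a) = const a * shifted_monom s u"
  by (subst shifted_sum_superset[of "{u}"]) (auto simp: lookup_single)

lemma shifted_sum_add: "shifted_sum s (c + d) = shifted_sum s c + shifted_sum s d"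
proof -
  let ?A = "Poly_Mapping.keys c \<union> Poly_Mapping.keys d"
  have "Poly_Mapping.keys (c + d) \<subseteq> ?A" by (rule keys_add)
  then show ?thesis
    by (simp add: shifted_sum_superset[of ?A] lookup_add const_add distrib_right sum.distrib)
qed

lemma shifted_monom_0 [simp]: "shifted_monom s 0 = 1"
  by (simp add: shifted_monom_def)

lemma shifted_monom_add: "shifted_monom s (u + v) = shifted_monom s u * shifted_monom s v"
  by (simp add: shifted_monom_def lookup_add power_add prod.distrib)

lemma mpoly_induct [case_names zero add]:
  assumes "P 0" and "\<And>c u a. P c \<Longrightarrow> P (c + Poly_Mapping.single u a)"
  shows "P (c :: ('b \<Rightarrow>\<^sub>0 'c::comm_monoid_add))"
proof (induction c rule: update_induct)
  case const
  then show ?case by (rule assms(1))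
next
  case (update f a b)
  have "Poly_Mapping.update a b f = f + Poly_Mapping.single a b"
    using update by (intro poly_mapping_eqI)
      (auto simp: lookup_update lookup_add lookup_single in_keys_iff when_def)
  with update assms(2) show ?case by simp
qed

lemma shifted_sum_mult: "shifted_sum s (c * d) = shifted_sum s c * shifted_sum s d"
proof (induction c rule: mpoly_induct)
  case (add c u a)
  have "shifted_sum s (Poly_Mapping.single u a * d) =
      const a * shifted_monom s u * shifted_sum s d"
    by (induction d rule: mpoly_induct)
      (simp_all add: distrib_left shifted_sum_add mult_single shifted_sum_single
        shifted_monom_add const_mult algebra_simps)
  with add show ?case
    by (simp add: distrib_right shifted_sum_add shifted_sum_single)
qed simp

lemma shifted_sum_const [simp]: "shifted_sum s (const a) = const a"
  unfolding const_def[of a] shifted_sum_single by (simp add: const_def)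

lemma shifted_sum_1 [simp]: "shifted_sum s 1 = 1"
  using shifted_sum_const[of s 1] by simp

lemma shifted_sum_uminus: "shifted_sum s (- c) = - shifted_sum s c"
  using shifted_sum_add[of s c "- c"] by (simp add: eq_neg_iff_add_eq_0 add.commute)

lemma shifted_sum_diff: "shifted_sum s (c - d) = shifted_sum s c - shifted_sum s d"
  using shifted_sum_add[of s c "- d"] by (simp add: shifted_sum_uminus)

lemma shifted_sum_var: "shifted_sum s (var i) = var i - const (s i)"
proof -
  have "shifted_monom s (Poly_Mapping.single i 1) = (var i - const (s i)) ^ 1"
    unfolding shifted_monom_def
    by (subst prod.remove[of _ i]) (auto simp: lookup_single)
  then show ?thesis
    by (simp add: var_def[of i] shifted_sum_single)
qed

lemma shifted_sum_power: "shifted_sum s (c ^ k) = shifted_sum s c ^ k"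
  by (induction k) (simp_all add: shifted_sum_mult)

lemma shifted_sum_prod: "shifted_sum s (\<Prod>i\<in>A. g i) = (\<Prod>i\<in>A. shifted_sum s (g i))"
  by (induction A rule: infinite_finite_induct) (simp_all add: shifted_sum_mult)

lemma single_eq_prod_var:
  fixes u :: "'n::finite \<Rightarrow>\<^sub>0 nat" and a :: "'a::comm_ring_1"
  shows "Poly_Mapping.single u a = const a * (\<Prod>i\<in>UNIV. var i ^ Poly_Mapping.lookup u i)"
proof -
  have pow: "(var i :: ('n, 'a) mpoly) ^ k = Poly_Mapping.single (Poly_Mapping.single i k) 1"
    for i k
    by (induction k) (simp_all add: var_def mult_single single_add[symmetric])
  have prod: "(\<Prod>i\<in>A. Poly_Mapping.single (g i) (1::'a)) = Poly_Mapping.single (\<Sum>i\<in>A. g i) 1"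
    for A :: "'n set" and g :: "'n \<Rightarrow> 'n \<Rightarrow>\<^sub>0 nat"
    by (induction A rule: infinite_finite_induct) (simp_all add: mult_single)
  have "(\<Sum>i\<in>UNIV. Poly_Mapping.single i (Poly_Mapping.lookup u i)) = u"
    by (rule poly_mapping_eqI) (simp add: lookup_sum lookup_single when_def)
  then show ?thesis
    by (simp add: pow prod const_def mult_single)
qed

lemma shifted_sum_inverse:
  fixes s :: "'n::finite \<Rightarrow> 'a::comm_ring_1"
  shows "shifted_sum (\<lambda>i. - s i) (shifted_sum s c) = c"
proof (induction c rule: mpoly_induct)
  case (add c u a)
  have "(const (- b) :: ('n, 'a) mpoly) = - const b" for b :: 'a
    by (simp add: const_def single_uminus)
  then have "shifted_sum (\<lambda>i. - s i) (shifted_monom s u) = (\<Prod>i\<in>UNIV. var i ^ Poly_Mapping.lookup u i)"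
    by (simp add: shifted_monom_def shifted_sum_prod shifted_sum_power shifted_sum_diff
        shifted_sum_var)
  with add show ?case
    by (simp add: shifted_sum_add shifted_sum_single shifted_sum_mult)
      (simp add: single_eq_prod_var)
qed simp

lemma ex1_expansion: "\<exists>!c. f = shifted_sum s c"
  using shifted_sum_inverse[of s] shifted_sum_inverse[of "\<lambda>i. - s i"]
  by (simp, metis)

end

theory Submission
  imports Defs
begin

text \<open>
  List the elements of the \<open>i\<close>-th multiset, with multiplicity, as \<open>a\<^sub>i 0, \<dots>, a\<^sub>i (d\<^sub>i - 1)\<close>,
  and continue the list arbitrarily. The products
  \<open>N\<^sub>u = \<Prod>\<^sub>i \<Prod>\<^bsub>j < u\<^sub>i\<^esub> (x\<^sub>i - a\<^sub>i j)\<close> (\<open>newton a u\<close> below) form a Newton basis of the polynomial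
  ring. It is triangular with respect to the monomials: \<open>x\<^sup>u\<close> is a combination of the \<open>N\<^sub>v\<close> with
  \<open>v \<le> u\<close> in every coordinate (\<open>monomial_eq_newton_sum\<close>), so expanding \<open>f\<close> in it raises neither
  the total degree nor the degree in any variable. The polynomial \<open>g\<^sub>i\<close> is the basis element
  at \<open>d\<^sub>i e\<^sub>i\<close>. Both halves of the theorem can be read off from this basis.

  Division: if \<open>u\<^sub>i < d\<^sub>i\<close> for all \<open>i\<close>, then \<open>N\<^sub>u\<close> belongs to the remainder. Otherwise
  \<open>u\<^sub>i \<ge> d\<^sub>i\<close> for some \<open>i\<close>, and \<open>N\<^sub>u\<close> is \<open>g\<^sub>i\<close> times a polynomial of total degree at most
  \<open>|u| - d\<^sub>i\<close>, which goes into \<open>h\<^sub>i\<close>. Expanding \<open>f\<close> and sorting its terms this way gives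
  \<open>grid_division\<close>.

  Uniqueness: a polynomial \<open>r\<close> in the grid ideal whose degree in each \<open>x\<^sub>i\<close> is below \<open>d\<^sub>i\<close> is zero
  (\<open>reduced_in_grid_ideal_eq_0\<close>). Suppose that \<open>r = \<Sum> c\<^sub>u N\<^sub>u\<close> is not zero and take \<open>u\<close> minimal with
  \<open>c\<^sub>u \<noteq> 0\<close>. Look at the node \<open>s\<close> with \<open>s\<^sub>i = a\<^sub>i u\<^sub>i\<close>, the first zero that \<open>N\<^sub>u\<close> leaves out in
  each direction, and let \<open>w\<^sub>i\<close> be the number of factors \<open>x\<^sub>i - s\<^sub>i\<close> of \<open>N\<^sub>u\<close>. Since \<open>N\<^sub>u\<close> has left
  out one occurrence of \<open>s\<^sub>i\<close>, the exponent \<open>w\<close> is strictly below the multiplicity of \<open>s\<close> in every coordinate. Any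
  other \<open>v\<close> with \<open>c\<^sub>v \<noteq> 0\<close> exceeds \<open>u\<close> in some coordinate \<open>i\<close>, so \<open>N\<^sub>v\<close> has more than \<open>w\<^sub>i\<close> factors
  \<open>x\<^sub>i - s\<^sub>i\<close> and does not contribute to the coefficient of \<open>(x - s)\<^sup>w\<close>. That coefficient of
  \<open>r\<close> is therefore \<open>c\<^sub>u\<close> times a nonzero number, although membership in the grid ideal forces it
  to vanish.

  The grid ideal contains the \<open>g\<^sub>i\<close>, so a remainder of one of its elements lies in it again and is
  zero, which gives the equality of ideals; and the difference of two remainders of the same
  polynomial lies in it and is zero, which gives uniqueness.
\<close>

section \<open>Coefficients of products\<close>

lemma keys_sum_subset: "Poly_Mapping.keys (sum f A) \<subseteq> (\<Union>i\<in>A. Poly_Mapping.keys (f i))"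
proof
  fix k
  assume "k \<in> Poly_Mapping.keys (sum f A)"
  then have "(\<Sum>i\<in>A. Poly_Mapping.lookup (f i) k) \<noteq> 0"
    by (simp add: in_keys_iff lookup_sum)
  then obtain i where "i \<in> A" "Poly_Mapping.lookup (f i) k \<noteq> 0"
    by (rule sum.not_neutral_contains_not_neutral)
  then show "k \<in> (\<Union>i\<in>A. Poly_Mapping.keys (f i))"
    by (auto simp: in_keys_iff)
qed

lemma keys_const_mult_subset:
  "Poly_Mapping.keys (const b * p) \<subseteq> Poly_Mapping.keys (p :: ('n, 'a::comm_ring_1) mpoly)"
  using keys_mult[of "const b" p] by (auto simp: const_def split: if_splits)

lemma poly_mapping_eq_sum_single:
  "p = (\<Sum>u\<in>Poly_Mapping.keys p. Poly_Mapping.single u (Poly_Mapping.lookup p u))"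
  by (rule poly_mapping_eqI) (simp add: lookup_sum lookup_single when_def in_keys_iff)

lemma exponent_induct [case_names zero plus_single]:
  fixes u :: "'n \<Rightarrow>\<^sub>0 nat"
  assumes "P 0" and step: "\<And>u i. P u \<Longrightarrow> P (u + Poly_Mapping.single i 1)"
  shows "P u"
proof (induction u rule: mpoly_induct)
  case (add u i k)
  show ?case
  proof (induction k)
    case (Suc k)
    have "u + Poly_Mapping.single i (Suc k) = u + Poly_Mapping.single i k + Poly_Mapping.single i 1"
      by (simp add: add.assoc flip: single_add)
    with step[OF Suc] show ?case by simp
  qed (use add in simp)
qed (fact assms(1))

lemma lookup_single_mult_plus:
  fixes p :: "('n, 'a::comm_ring_1) mpoly"
  shows "Poly_Mapping.lookup (Poly_Mapping.single e b * p) (e + w) = b * Poly_Mapping.lookup p w"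
  by (induction p rule: mpoly_induct)
    (simp_all add: distrib_left lookup_add mult_single lookup_single when_def)

text \<open>A monomial factor \<open>x\<^sup>e\<close> kills every coefficient at an exponent that \<open>e\<close> exceeds somewhere.\<close>

lemma lookup_single_mult_eq_0:
  fixes p :: "('n, 'a::comm_ring_1) mpoly"
  assumes "Poly_Mapping.lookup w i < Poly_Mapping.lookup e i"
  shows "Poly_Mapping.lookup (Poly_Mapping.single e b * p) w = 0"
proof -
  have "e + u \<noteq> w" for u
    using assms by (auto simp: lookup_add)
  then show ?thesis
    by (induction p rule: mpoly_induct)
      (simp_all add: distrib_left lookup_add mult_single lookup_single when_def)
qed

text \<open>Taking constant terms is multiplicative, because exponents cannot cancel.\<close>

lemma lookup_mult_zero:
  fixes p :: "('n, 'a::comm_ring_1) mpoly"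
  shows "Poly_Mapping.lookup (p * q) 0 = Poly_Mapping.lookup p 0 * Poly_Mapping.lookup q 0"
proof (induction p rule: mpoly_induct)
  case (add p u b)
  have "Poly_Mapping.lookup (Poly_Mapping.single u b * q) 0 =
    Poly_Mapping.lookup (Poly_Mapping.single u b) 0 * Poly_Mapping.lookup q 0"
  proof (cases "u = 0")
    case True
    then show ?thesis using lookup_single_mult_plus[of 0 b q 0] by simp
  next
    case False
    then obtain i where "Poly_Mapping.lookup u i \<noteq> 0"
      by (metis lookup_zero poly_mapping_eqI)
    with False show ?thesis
      by (subst lookup_single_mult_eq_0[of _ i]) (auto simp: lookup_single)
  qed
  with add show ?case by (simp add: distrib_right lookup_add)
qed simp

lemma lookup_prod_zero:
  fixes p :: "'i \<Rightarrow> ('n, 'a::comm_ring_1) mpoly"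
  shows "Poly_Mapping.lookup (\<Prod>i\<in>A. p i) 0 = (\<Prod>i\<in>A. Poly_Mapping.lookup (p i) 0)"
  by (induction A rule: infinite_finite_induct) (simp_all add: lookup_mult_zero)

section \<open>Newton bases\<close>

text \<open>
  The nodes are a sequence in each variable rather than a finite list, so that \<open>newton a u\<close> is
  available for all exponents \<open>u\<close> and the whole polynomial ring is covered. For constant sequences
  these are the shifted monomials.
\<close>

definition newton ::
    "('n::finite \<Rightarrow> nat \<Rightarrow> 'a::comm_ring_1) \<Rightarrow> ('n \<Rightarrow>\<^sub>0 nat) \<Rightarrow> ('n, 'a) mpoly"
  where "newton a u = (\<Prod>i\<in>UNIV. \<Prod>j<Poly_Mapping.lookup u i. var i - const (a i j))"

lemma newton_0 [simp]: "newton a 0 = 1"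
  by (simp add: newton_def)

text \<open>
  Splitting off the first \<open>u\<^sub>i\<close> factors in each variable leaves a Newton element for the
  remaining nodes. With \<open>v = e\<^sub>i\<close> this is the recursion of the basis; with \<open>u = d\<^sub>i e\<^sub>i\<close> it is the
  division by \<open>g\<^sub>i\<close>.
\<close>

lemma newton_add:
  fixes a :: "'n::finite \<Rightarrow> nat \<Rightarrow> 'a::comm_ring_1"
  shows "newton a (u + v) = newton a u * newton (\<lambda>i j. a i (Poly_Mapping.lookup u i + j)) v"
proof -
  have "(\<Prod>j<k + l. f j) = (\<Prod>j<k. f j) * (\<Prod>j<l. f (k + j))"
    for k l and f :: "nat \<Rightarrow> ('n, 'a) mpoly"
    by (induction l) (simp_all add: mult.assoc)
  then show ?thesis
    by (simp add: newton_def lookup_add prod.distrib)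
qed

lemma newton_single: "newton a (Poly_Mapping.single i k) = (\<Prod>j<k. var i - const (a i j))"
  unfolding newton_def
  by (subst prod.remove[of _ i]) (auto simp: lookup_single)

lemma newton_plus_single:
  "newton a (u + Poly_Mapping.single i 1) =
    newton a u * (var i - const (a i (Poly_Mapping.lookup u i)))"
  by (simp add: newton_add newton_single)

lemma keys_newton:
  fixes a :: "'n::finite \<Rightarrow> nat \<Rightarrow> 'a::comm_ring_1"
  assumes "v \<in> Poly_Mapping.keys (newton a u)"
  shows "Poly_Mapping.lookup v i \<le> Poly_Mapping.lookup u i"
  using assms
proof (induction u arbitrary: v i rule: exponent_induct)
  case (plus_single u k)
  let ?c = "const (a k (Poly_Mapping.lookup u k)) :: ('n, 'a) mpoly"
  have "Poly_Mapping.keys (var k - ?c) \<subseteq> {Poly_Mapping.single k 1, 0}"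
    by (auto simp: var_def const_def in_keys_iff lookup_minus lookup_single when_def
        split: if_splits)
  with plus_single.prems obtain w e where "v = w + e" "w \<in> Poly_Mapping.keys (newton a u)"
    "e = Poly_Mapping.single k 1 \<or> e = 0"
    unfolding newton_plus_single using keys_mult by blast
  with plus_single.IH[of w i] show ?case
    by (auto simp: lookup_add)
qed simp

lemma shifted_sum_newton:
  "shifted_sum s (newton a u) = newton (\<lambda>i j. a i j + s i) u"
  by (simp add: newton_def shifted_sum_prod shifted_sum_diff shifted_sum_var const_add
      algebra_simps)

definition newton_sum ::
    "('n::finite \<Rightarrow> nat \<Rightarrow> 'a::comm_ring_1) \<Rightarrow> ('n, 'a) mpoly \<Rightarrow> ('n, 'a) mpoly"
  where "newton_sum a c =
    (\<Sum>u\<in>Poly_Mapping.keys c. const (Poly_Mapping.lookup c u) * newton a u)"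

lemma newton_sum_superset:
  assumes "finite A" "Poly_Mapping.keys c \<subseteq> A"
  shows "newton_sum a c = (\<Sum>u\<in>A. const (Poly_Mapping.lookup c u) * newton a u)"
  unfolding newton_sum_def
  by (rule sum.mono_neutral_left) (use assms in \<open>auto simp: in_keys_iff\<close>)

lemma newton_sum_single:
  "newton_sum a (Poly_Mapping.single u b) = const b * newton a u"
  by (subst newton_sum_superset[of "{u}"]) (auto simp: lookup_single)

lemma newton_sum_add: "newton_sum a (c + d) = newton_sum a c + newton_sum a d"
proof -
  let ?A = "Poly_Mapping.keys c \<union> Poly_Mapping.keys d"
  have "Poly_Mapping.keys (c + d) \<subseteq> ?A" by (rule keys_add)
  then show ?thesis
    by (simp add: newton_sum_superset[of ?A] lookup_add const_add distrib_right sum.distrib)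
qed

lemma newton_sum_sum: "newton_sum a (\<Sum>i\<in>A. c i) = (\<Sum>i\<in>A. newton_sum a (c i))"
  by (induction A rule: infinite_finite_induct) (simp_all add: newton_sum_add, simp_all add: newton_sum_def)

text \<open>
  Induction on the exponent: multiplication by a variable keeps the domination by the exponent,
  since \<open>x\<^sub>i N\<^sub>v = N\<^bsub>v + e\<^sub>i\<^esub> + a\<^sub>i v\<^sub>i N\<^sub>v\<close>.
\<close>

lemma monomial_eq_newton_sum:
  "\<exists>c. Poly_Mapping.single u b = newton_sum a c \<and>
    (\<forall>v\<in>Poly_Mapping.keys c. \<forall>i. Poly_Mapping.lookup v i \<le> Poly_Mapping.lookup u i)"
proof (induction u rule: exponent_induct)
  case zero
  show ?case
    by (rule exI[of _ "Poly_Mapping.single 0 b"]) (simp add: newton_sum_single const_def)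
next
  case (plus_single u i)
  then obtain c where c: "Poly_Mapping.single u b = newton_sum a c"
    "\<And>v j. v \<in> Poly_Mapping.keys c \<Longrightarrow> Poly_Mapping.lookup v j \<le> Poly_Mapping.lookup u j"
    by blast
  \<comment> \<open>The coefficients of \<open>x\<^sub>i\<close> times the term at \<open>v\<close>.\<close>
  define step where "step v =
    Poly_Mapping.single (v + Poly_Mapping.single i 1) (Poly_Mapping.lookup c v) +
    Poly_Mapping.single v (a i (Poly_Mapping.lookup v i) * Poly_Mapping.lookup c v)" for v
  let ?d = "\<Sum>v\<in>Poly_Mapping.keys c. step v"
  have "Poly_Mapping.single (u + Poly_Mapping.single i 1) b = var i * Poly_Mapping.single u b"
    by (simp add: var_def mult_single add.commute)
  also have "\<dots> = (\<Sum>v\<in>Poly_Mapping.keys c. var i * (const (Poly_Mapping.lookup c v) * newton a v))"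
    by (simp add: c(1) newton_sum_def sum_distrib_left)
  also have "\<dots> = newton_sum a ?d"
    unfolding newton_sum_sum
  proof (rule sum.cong)
    fix v
    have "var i * newton a v = newton a (v + Poly_Mapping.single i 1) +
        const (a i (Poly_Mapping.lookup v i)) * newton a v"
      unfolding newton_plus_single by (simp add: algebra_simps)
    then have "const (Poly_Mapping.lookup c v) * (var i * newton a v) = newton_sum a (step v)"
      by (simp only: step_def newton_sum_add newton_sum_single const_mult distrib_left ac_simps)
    then show "var i * (const (Poly_Mapping.lookup c v) * newton a v) = newton_sum a (step v)"
      by (simp only: ac_simps)
  qed simp
  finally have "Poly_Mapping.single (u + Poly_Mapping.single i 1) b = newton_sum a ?d" .
  moreover have "Poly_Mapping.lookup w j \<le> Poly_Mapping.lookup (u + Poly_Mapping.single i 1) j"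
    if "w \<in> Poly_Mapping.keys ?d" for w j
  proof -
    from that obtain v where v: "v \<in> Poly_Mapping.keys c" "w \<in> Poly_Mapping.keys (step v)"
      using keys_sum_subset[of step] by blast
    then have "w = v + Poly_Mapping.single i 1 \<or> w = v"
      unfolding step_def using keys_add by (fastforce split: if_splits)
    with c(2)[OF v(1), of j] show ?thesis
      by (auto simp: lookup_add)
  qed
  ultimately show ?case by blast
qed

text \<open>
  The domination of the exponents controls the total degree and the degrees in
  all variables at once.
\<close>

lemma eq_newton_sum:
  obtains c where "f = newton_sum a c"
    "\<And>u. u \<in> Poly_Mapping.keys c \<Longrightarrow>
      \<exists>v\<in>Poly_Mapping.keys f. \<forall>i. Poly_Mapping.lookup u i \<le> Poly_Mapping.lookup v i"
proof -
  have "\<forall>u. \<exists>c. Poly_Mapping.single u (Poly_Mapping.lookup f u) = newton_sum a c \<and>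
    (\<forall>v\<in>Poly_Mapping.keys c. \<forall>i. Poly_Mapping.lookup v i \<le> Poly_Mapping.lookup u i)"
    using monomial_eq_newton_sum by blast
  then obtain c where
    c: "\<And>u. Poly_Mapping.single u (Poly_Mapping.lookup f u) = newton_sum a (c u)"
      "\<And>u v i. v \<in> Poly_Mapping.keys (c u) \<Longrightarrow> Poly_Mapping.lookup v i \<le> Poly_Mapping.lookup u i"
    by metis
  have "f = newton_sum a (\<Sum>u\<in>Poly_Mapping.keys f. c u)"
    by (subst poly_mapping_eq_sum_single) (simp add: newton_sum_sum c(1))
  then show ?thesis
    by (rule that) (use c(2) keys_sum_subset[of c] in blast)
qed

section \<open>Newton basis elements around a node\<close>

text \<open>
  After the node \<open>s\<close> has been translated to the origin, the factors \<open>x\<^sub>i - s\<^sub>i\<close> of a Newton element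
  are those with \<open>b\<^sub>i j = 0\<close>; \<open>zero_count b u\<close> is its exponent of vanishing at the node.
\<close>

definition zero_count ::
    "('n::finite \<Rightarrow> nat \<Rightarrow> 'a::zero) \<Rightarrow> ('n \<Rightarrow>\<^sub>0 nat) \<Rightarrow> ('n \<Rightarrow>\<^sub>0 nat)"
  where "zero_count b u =
    Abs_poly_mapping (\<lambda>i. card {j. j < Poly_Mapping.lookup u i \<and> b i j = 0})"

lemma lookup_zero_count:
  "Poly_Mapping.lookup (zero_count b u) i = card {j. j < Poly_Mapping.lookup u i \<and> b i j = 0}"
  by (simp add: zero_count_def)

lemma newton_split_zeros:
  "newton b u = Poly_Mapping.single (zero_count b u) 1 *
    (\<Prod>i\<in>UNIV. \<Prod>j | j < Poly_Mapping.lookup u i \<and> b i j \<noteq> 0. var i - const (b i j))"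
proof -
  have "(\<Prod>j<Poly_Mapping.lookup u i. var i - const (b i j)) =
      var i ^ Poly_Mapping.lookup (zero_count b u) i *
      (\<Prod>j | j < Poly_Mapping.lookup u i \<and> b i j \<noteq> 0. var i - const (b i j))" for i
  proof -
    let ?Z = "{j. j < Poly_Mapping.lookup u i \<and> b i j = 0}"
    let ?N = "{j. j < Poly_Mapping.lookup u i \<and> b i j \<noteq> 0}"
    have "{..<Poly_Mapping.lookup u i} = ?Z \<union> ?N" by auto
    then have "(\<Prod>j<Poly_Mapping.lookup u i. var i - const (b i j)) =
        (\<Prod>j\<in>?Z. var i - const (b i j)) * (\<Prod>j\<in>?N. var i - const (b i j))"
      by (simp add: prod.union_disjoint disjoint_iff)
    also have "(\<Prod>j\<in>?Z. var i - const (b i j)) = (\<Prod>j\<in>?Z. var i)"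
      by (rule prod.cong) simp_all
    finally show ?thesis by (simp add: lookup_zero_count)
  qed
  then show ?thesis
    by (simp add: newton_def prod.distrib single_eq_prod_var)
qed

text \<open>The coefficient is the constant term of the cofactor, a product of nonzero \<open>- b\<^sub>i j\<close>.\<close>

lemma lookup_newton_zero_count_neq_0:
  fixes b :: "'n::finite \<Rightarrow> nat \<Rightarrow> 'a::idom"
  shows "Poly_Mapping.lookup (newton b u) (zero_count b u) \<noteq> 0"
proof -
  have "Poly_Mapping.lookup (var i - const (b i j)) 0 = - b i j" for i j
    by (simp add: lookup_minus var_def const_def lookup_single when_def)
      (metis lookup_single_eq lookup_zero nat.distinct(1))
  then show ?thesis
    unfolding newton_split_zeros
    using lookup_single_mult_plus[of "zero_count b u" "1 :: 'a" _ 0, unfolded add_0_right]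
    by (simp add: lookup_prod_zero)
qed

text \<open>
  Expanding around \<open>s\<close> is the substitution of \<open>x + s\<close> for \<open>x\<close>, hence a ring homomorphism.
\<close>

lemma expansion_eq_shifted_sum: "expansion s f = shifted_sum (\<lambda>i. - s i) f"
  unfolding expansion_def
proof (rule the_equality)
  show "f = shifted_sum s (shifted_sum (\<lambda>i. - s i) f)"
    using shifted_sum_inverse[of "\<lambda>i. - s i" f] by simp
qed (simp add: shifted_sum_inverse)

text \<open>
  One test coefficient for each \<open>u\<close> in the support detects whether a Newton sum is zero. The matrix
  of these tests against the basis is triangular: at the node \<open>s\<^sub>i = a\<^sub>i u\<^sub>i\<close>, every \<open>N\<^sub>v\<close> with
  \<open>v\<^sub>i > u\<^sub>i\<close> has more factors \<open>x\<^sub>i - s\<^sub>i\<close> than \<open>N\<^sub>u\<close>, because of the one with index \<open>u\<^sub>i\<close>.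
\<close>

lemma newton_sum_eq_0:
  fixes a :: "'n::finite \<Rightarrow> nat \<Rightarrow> 'a::idom"
  assumes vanish: "\<And>u. u \<in> Poly_Mapping.keys c \<Longrightarrow>
      Poly_Mapping.lookup (expansion (\<lambda>i. a i (Poly_Mapping.lookup u i)) (newton_sum a c))
        (zero_count (\<lambda>i j. a i j - a i (Poly_Mapping.lookup u i)) u) = 0"
  shows "newton_sum a c = 0"
proof (cases "Poly_Mapping.keys c = {}")
  case False
  let ?size = "\<lambda>u :: 'n \<Rightarrow>\<^sub>0 nat. \<Sum>i\<in>UNIV. Poly_Mapping.lookup u i"
  \<comment> \<open>Least total degree ensures that no other exponent of the support lies below \<open>u\<close> in
    every coordinate.\<close>
  from False obtain u where u: "u \<in> Poly_Mapping.keys c"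
    and least: "\<And>v. v \<in> Poly_Mapping.keys c \<Longrightarrow> ?size u \<le> ?size v"
    using ex_has_least_nat[of "\<lambda>u. u \<in> Poly_Mapping.keys c" _ ?size] by blast
  define s where "s = (\<lambda>i. a i (Poly_Mapping.lookup u i))"
  define b where "b = (\<lambda>i j. a i j - s i)"
  let ?w = "zero_count b u"
  have others: "Poly_Mapping.lookup (newton b v) ?w = 0"
    if v: "v \<in> Poly_Mapping.keys c" "v \<noteq> u" for v
  proof -
    have "\<exists>i. Poly_Mapping.lookup u i < Poly_Mapping.lookup v i"
    proof (rule ccontr)
      assume "\<not> ?thesis"
      then have le: "\<And>i. Poly_Mapping.lookup v i \<le> Poly_Mapping.lookup u i"
        by (simp add: not_less)
      from v(2) obtain i where "Poly_Mapping.lookup v i \<noteq> Poly_Mapping.lookup u i"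
        by (metis poly_mapping_eqI)
      with le have "?size v < ?size u"
        by (intro sum_strict_mono_ex1) (auto simp: le_less)
      with least[OF v(1)] show False by simp
    qed
    then obtain i where i: "Poly_Mapping.lookup u i < Poly_Mapping.lookup v i" ..
    then have "{j. j < Poly_Mapping.lookup u i \<and> b i j = 0} \<subset>
        {j. j < Poly_Mapping.lookup v i \<and> b i j = 0}"
      by (auto simp: b_def s_def)
    then have "Poly_Mapping.lookup ?w i < Poly_Mapping.lookup (zero_count b v) i"
      unfolding lookup_zero_count by (rule psubset_card_mono[rotated]) simp
    then show ?thesis
      unfolding newton_split_zeros[of b v] by (rule lookup_single_mult_eq_0)
  qed
  have "expansion s (newton_sum a c) =
      (\<Sum>v\<in>Poly_Mapping.keys c. const (Poly_Mapping.lookup c v) * newton b v)"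
  proof -
    have "shifted_sum t (sum p A) = (\<Sum>x\<in>A. shifted_sum t (p x))"
      for t :: "'n \<Rightarrow> 'a" and p and A :: "('n \<Rightarrow>\<^sub>0 nat) set"
      by (induction A rule: infinite_finite_induct) (simp_all add: shifted_sum_add)
    then show ?thesis
      by (simp add: expansion_eq_shifted_sum newton_sum_def shifted_sum_mult
          shifted_sum_newton b_def)
  qed
  then have "Poly_Mapping.lookup (expansion s (newton_sum a c)) ?w =
      (\<Sum>v\<in>Poly_Mapping.keys c. Poly_Mapping.lookup c v * Poly_Mapping.lookup (newton b v) ?w)"
    by (simp add: lookup_sum const_def lookup_single_mult_plus[of 0 _ _ ?w, unfolded add_0])
  also have "\<dots> = Poly_Mapping.lookup c u * Poly_Mapping.lookup (newton b u) ?w"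
    by (subst sum.remove[OF _ u]) (simp_all add: others)
  finally have "Poly_Mapping.lookup (expansion s (newton_sum a c)) ?w \<noteq> 0"
    using u lookup_newton_zero_count_neq_0[of b u] by (simp add: in_keys_iff)
  moreover have "Poly_Mapping.lookup (expansion s (newton_sum a c)) ?w = 0"
    using vanish[OF u] by (simp add: s_def b_def)
  ultimately show ?thesis by contradiction
qed (simp add: newton_sum_def)

section \<open>Grid polynomials and their ideal\<close>

definition enumerates :: "(nat \<Rightarrow> 'a) \<Rightarrow> 'a multiset \<Rightarrow> bool"
  where "enumerates a A \<longleftrightarrow> image_mset a (mset_set {..<size A}) = A"

lemma ex_enumerates: "\<exists>a. \<forall>i. enumerates (a i) (M i)"
proof (rule choice, rule allI)
  fix i
  let ?A = "M i"
  obtain xs where "mset xs = ?A" using ex_mset by blast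
  moreover have "image_mset ((!) xs) (mset_set {..<length xs}) = mset (map ((!) xs) [0..<length xs])"
    by (simp add: lessThan_atLeast0)
  ultimately have "enumerates ((!) xs) ?A"
    unfolding enumerates_def by (metis map_nth size_mset)
  then show "\<exists>a. enumerates a ?A" by (rule exI[of _ "(!) xs"])
qed

lemma count_enumerates:
  assumes "enumerates a A"
  shows "count A x = card {j. j < size A \<and> a j = x}"
proof -
  have "count A x = count (image_mset a (mset_set {..<size A})) x"
    using assms by (simp add: enumerates_def)
  also have "\<dots> = card {j. j < size A \<and> a j = x}"
    by (simp add: count_image_mset') (metis)
  finally show ?thesis .
qed

lemma enumerates_in:
  assumes "enumerates a A" "j < size A"
  shows "a j \<in># A"
proof -
  have "a j \<in># image_mset a (mset_set {..<size A})" using assms(2) by simp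
  with assms(1) show ?thesis by (simp add: enumerates_def)
qed

lemma grid_poly_eq_newton:
  fixes M :: "'n::finite \<Rightarrow> 'a::comm_ring_1 multiset"
  assumes "enumerates (a i) (M i)"
  shows "grid_poly M i = newton a (Poly_Mapping.single i (size (M i)))"
proof -
  have "grid_poly M i = (\<Prod>x\<in>#M i. var i - const x)"
    unfolding grid_poly_def by (rule image_prod_mset_multiplicity[symmetric])
  also have "\<dots> = (\<Prod>x\<in>#image_mset (a i) (mset_set {..<size (M i)}). var i - const x)"
    using assms by (simp add: enumerates_def)
  also have "\<dots> = (\<Prod>j<size (M i). var i - const (a i j))"
    by (simp add: prod_unfold_prod_mset image_mset.compositionality o_def)
  finally show ?thesis by (simp add: newton_single)
qed

text \<open>
  The exponents below \<open>w\<close> are closed downwards, and a coefficient of \<open>p * q\<close> involves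
  only coefficients of \<open>q\<close> at smaller exponents.
\<close>

lemma point_ideal_subspace:
  "module.subspace (*) (point_ideal s w :: ('n::finite, 'a::comm_ring_1) mpoly set)"
proof -
  interpret module "(*) :: ('n, 'a) mpoly \<Rightarrow> _" by (rule module_times)
  have "Poly_Mapping.lookup (p * q) u = 0"
    if q: "\<And>u. (\<And>i. Poly_Mapping.lookup u i < w i) \<Longrightarrow> Poly_Mapping.lookup q u = 0"
      and u: "\<And>i. Poly_Mapping.lookup u i < w i" for p q :: "('n, 'a) mpoly" and u
  proof (induction p rule: mpoly_induct)
    case (add p e b)
    have "Poly_Mapping.lookup (Poly_Mapping.single e b * q) u = 0"
    proof (cases "\<exists>i. Poly_Mapping.lookup u i < Poly_Mapping.lookup e i")
      case True
      then show ?thesis by (auto intro: lookup_single_mult_eq_0)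
    next
      case False
      then have "u = e + (u - e)"
        by (intro poly_mapping_eqI) (simp add: lookup_add lookup_minus not_less)
      moreover have "Poly_Mapping.lookup q (u - e) = 0"
        by (rule q) (simp add: lookup_minus u less_imp_diff_less)
      ultimately show ?thesis
        using lookup_single_mult_plus[of e b q "u - e"] by simp
    qed
    with add show ?case by (simp add: distrib_right lookup_add)
  qed simp
  then show ?thesis
    by (intro subspaceI)
      (auto simp: point_ideal_def expansion_eq_shifted_sum shifted_sum_add shifted_sum_mult lookup_add)
qed

lemma grid_ideal_subspace:
  "module.subspace (*) (grid_ideal M :: ('n::finite, 'a::comm_ring_1) mpoly set)"
proof -
  interpret module "(*) :: ('n, 'a) mpoly \<Rightarrow> _" by (rule module_times)
  show ?thesis
    unfolding grid_ideal_def by (rule subspace_Inter) (auto intro: point_ideal_subspace)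
qed

lemma grid_poly_in_grid_ideal:
  fixes M :: "'n::finite \<Rightarrow> 'a::comm_ring_1 multiset"
  shows "grid_poly M i \<in> grid_ideal M"
proof -
  obtain a where a: "\<And>i. enumerates (a i) (M i)"
    using ex_enumerates[of M] by blast
  have "Poly_Mapping.lookup (expansion s (grid_poly M i)) u = 0"
    if "Poly_Mapping.lookup u i < count (M i) (s i)" for s u
  proof -
    let ?b = "\<lambda>i j. a i j - s i"
    have "expansion s (grid_poly M i) = newton ?b (Poly_Mapping.single i (size (M i)))"
      by (simp add: grid_poly_eq_newton[of a i M, OF a] expansion_eq_shifted_sum shifted_sum_newton)
    moreover have "Poly_Mapping.lookup u i <
        Poly_Mapping.lookup (zero_count ?b (Poly_Mapping.single i (size (M i)))) i"
      using that by (simp add: lookup_zero_count count_enumerates[OF a])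
    ultimately show ?thesis
      by (simp add: newton_split_zeros lookup_single_mult_eq_0)
  qed
  then show ?thesis
    by (simp add: grid_ideal_def point_ideal_def)
qed

lemma degree_in_less_iff:
  "degree_in i p < ereal (real d) \<longleftrightarrow> (\<forall>u\<in>Poly_Mapping.keys p. Poly_Mapping.lookup u i < d)"
proof (cases "Poly_Mapping.keys p = {}")
  case True
  then show ?thesis by (simp add: degree_in_def bot_ereal_def)
next
  case False
  then show ?thesis
    unfolding degree_in_def by (subst finite_Sup_less_iff) auto
qed

text \<open>
  For \<open>u\<^sub>i < d\<^sub>i\<close> the test node of \<open>newton_sum_eq_0\<close> lies in the grid and the test exponent
  below its multiplicity, so that membership in the grid ideal supplies all the tests.
\<close>

lemma reduced_in_grid_ideal_eq_0:
  fixes M :: "'n::finite \<Rightarrow> 'a::idom multiset"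
  assumes r: "r \<in> grid_ideal M" and deg: "\<And>i. degree_in i r < ereal (real (size (M i)))"
  shows "r = 0"
proof -
  obtain a where a: "\<And>i. enumerates (a i) (M i)"
    using ex_enumerates[of M] by blast
  obtain c where c: "r = newton_sum a c"
    and dom: "\<And>u. u \<in> Poly_Mapping.keys c \<Longrightarrow>
      \<exists>v\<in>Poly_Mapping.keys r. \<forall>i. Poly_Mapping.lookup u i \<le> Poly_Mapping.lookup v i"
    using eq_newton_sum[of r a] by blast
  have small: "Poly_Mapping.lookup u i < size (M i)" if "u \<in> Poly_Mapping.keys c" for u i
    using dom[OF that] deg by (meson degree_in_less_iff le_less_trans)
  have "newton_sum a c = 0"
  proof (rule newton_sum_eq_0)
    fix u
    assume u: "u \<in> Poly_Mapping.keys c"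
    let ?s = "\<lambda>i. a i (Poly_Mapping.lookup u i)"
    let ?w = "zero_count (\<lambda>i j. a i j - ?s i) u"
    have "?s \<in> grid M"
      using small[OF u] by (simp add: grid_def enumerates_in[OF a])
    moreover have "Poly_Mapping.lookup ?w i < count (M i) (?s i)" for i
    proof -
      \<comment> \<open>Index \<open>u\<^sub>i\<close> itself is an occurrence of \<open>s\<^sub>i\<close>, and it is not among the first \<open>u\<^sub>i\<close> indices.\<close>
      have "Poly_Mapping.lookup u i \<in> {j. j < size (M i) \<and> a i j = ?s i}"
        using small[OF u] by simp
      then have "{j. j < Poly_Mapping.lookup u i \<and> a i j - ?s i = 0} \<subset>
          {j. j < size (M i) \<and> a i j = ?s i}"
        using small[OF u, of i] by auto
      then show ?thesis
        unfolding lookup_zero_count count_enumerates[OF a]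
        by (rule psubset_card_mono[rotated]) simp
    qed
    ultimately show "Poly_Mapping.lookup (expansion ?s (newton_sum a c)) ?w = 0"
      using r by (simp add: grid_ideal_def point_ideal_def flip: c)
  qed
  with c show ?thesis by simp
qed

section \<open>Division by the grid polynomials\<close>

lemma total_degree_le_diff:
  assumes "\<And>v. v \<in> Poly_Mapping.keys h \<Longrightarrow> \<exists>u\<in>Poly_Mapping.keys f.
    (\<Sum>i\<in>UNIV. Poly_Mapping.lookup v i) + d \<le> (\<Sum>i\<in>UNIV. Poly_Mapping.lookup u i)"
  shows "total_degree h \<le> total_degree f - ereal (real d)"
  unfolding total_degree_def[of h]
proof (rule SUP_least)
  fix v
  let ?size = "\<lambda>v. \<Sum>i\<in>UNIV. Poly_Mapping.lookup v i"
  assume "v \<in> Poly_Mapping.keys h"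
  with assms obtain u where u: "u \<in> Poly_Mapping.keys f" "?size v + d \<le> ?size u"
    by blast
  have "ereal (real (?size v)) \<le> ereal (real (?size u)) - ereal (real d)"
    using of_nat_mono[OF u(2), where 'a = real] by simp
  also have "\<dots> \<le> total_degree f - ereal (real d)"
    unfolding total_degree_def using u(1)
    by (intro ereal_minus_mono) (auto intro: SUP_upper)
  finally show "ereal (real (?size v)) \<le> total_degree f - ereal (real d)" .
qed

text \<open>
  A single basis element is either all remainder or a multiple of one \<open>g\<^sub>i\<close>, so no reduction
  has to be iterated.
\<close>

lemma newton_division:
  fixes M :: "'n::finite \<Rightarrow> 'a::comm_ring_1 multiset"
  assumes a: "\<And>i. enumerates (a i) (M i)"
  shows "\<exists>r h. newton a u = r + (\<Sum>i\<in>UNIV. h i * grid_poly M i) \<and>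
    (\<forall>v\<in>Poly_Mapping.keys r. \<forall>i. Poly_Mapping.lookup v i < size (M i)) \<and>
    (\<forall>i. \<forall>v\<in>Poly_Mapping.keys (h i).
      (\<Sum>i\<in>UNIV. Poly_Mapping.lookup v i) + size (M i) \<le> (\<Sum>i\<in>UNIV. Poly_Mapping.lookup u i))"
proof (cases "\<forall>i. Poly_Mapping.lookup u i < size (M i)")
  case True
  then have "\<forall>v\<in>Poly_Mapping.keys (newton a u). \<forall>i. Poly_Mapping.lookup v i < size (M i)"
    using keys_newton le_less_trans by blast
  then show ?thesis
    by (intro exI[of _ "newton a u"] exI[of _ "\<lambda>_. 0"]) simp
next
  case False
  then obtain i where i: "size (M i) \<le> Poly_Mapping.lookup u i"
    by (auto simp: not_less)
  let ?e = "Poly_Mapping.single i (size (M i))"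
  define q where "q = newton (\<lambda>k j. a k (Poly_Mapping.lookup ?e k + j)) (u - ?e)"
  have split: "?e + (u - ?e) = u"
    using i by (intro poly_mapping_eqI) (auto simp: lookup_add lookup_minus lookup_single when_def)
  then have "newton a u = q * grid_poly M i"
    using newton_add[of a ?e "u - ?e"] grid_poly_eq_newton[of a i M, OF a]
    by (simp add: q_def mult.commute)
  also have "\<dots> = (\<Sum>k\<in>UNIV. (if k = i then q else 0) * grid_poly M k)"
    by (simp add: if_distrib[of "\<lambda>x. x * _"] cong: if_cong)
  finally have eq: "newton a u = (\<Sum>k\<in>UNIV. (if k = i then q else 0) * grid_poly M k)" .
  have "(\<Sum>k\<in>UNIV. Poly_Mapping.lookup v k) + size (M i) \<le> (\<Sum>k\<in>UNIV. Poly_Mapping.lookup u k)"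
    if "v \<in> Poly_Mapping.keys q" for v
  proof -
    have "(\<Sum>k\<in>UNIV. Poly_Mapping.lookup v k) \<le> (\<Sum>k\<in>UNIV. Poly_Mapping.lookup (u - ?e) k)"
      using that unfolding q_def by (intro sum_mono) (rule keys_newton)
    moreover have "(\<Sum>k\<in>UNIV. Poly_Mapping.lookup ?e k) = size (M i)"
      by (simp add: lookup_single when_def)
    moreover have "(\<Sum>k\<in>UNIV. Poly_Mapping.lookup u k) =
        (\<Sum>k\<in>UNIV. Poly_Mapping.lookup ?e k) + (\<Sum>k\<in>UNIV. Poly_Mapping.lookup (u - ?e) k)"
      by (simp only: lookup_add flip: sum.distrib) (simp only: split flip: lookup_add)
    ultimately show ?thesis by simp
  qed
  with eq show ?thesis
    by (intro exI[of _ 0] exI[of _ "\<lambda>k. if k = i then q else 0"]) auto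
qed

lemma grid_division:
  fixes M :: "'n::finite \<Rightarrow> 'a::comm_ring_1 multiset" and f :: "('n, 'a) mpoly"
  obtains r h where "f = r + (\<Sum>i\<in>UNIV. h i * grid_poly M i)"
    "\<And>i. total_degree (h i) \<le> total_degree f - ereal (real (size (M i)))"
    "\<And>i. degree_in i r < ereal (real (size (M i)))"
proof -
  let ?size = "\<lambda>u :: 'n \<Rightarrow>\<^sub>0 nat. \<Sum>i\<in>UNIV. Poly_Mapping.lookup u i"
  obtain a where a: "\<And>i. enumerates (a i) (M i)"
    using ex_enumerates[of M] by blast
  obtain c where c: "f = newton_sum a c"
    and dom: "\<And>u. u \<in> Poly_Mapping.keys c \<Longrightarrow>
      \<exists>v\<in>Poly_Mapping.keys f. \<forall>i. Poly_Mapping.lookup u i \<le> Poly_Mapping.lookup v i"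
    using eq_newton_sum[of f a] by blast
  have "\<forall>u. \<exists>r h. newton a u = r + (\<Sum>i\<in>UNIV. h i * grid_poly M i) \<and>
    (\<forall>v\<in>Poly_Mapping.keys r. \<forall>i. Poly_Mapping.lookup v i < size (M i)) \<and>
    (\<forall>i. \<forall>v\<in>Poly_Mapping.keys (h i). ?size v + size (M i) \<le> ?size u)"
    by (intro allI newton_division a)
  then obtain r h where
    rh: "\<And>u. newton a u = r u + (\<Sum>i\<in>UNIV. h u i * grid_poly M i)"
    and r: "\<And>u v i. v \<in> Poly_Mapping.keys (r u) \<Longrightarrow> Poly_Mapping.lookup v i < size (M i)"
    and h: "\<And>u v i. v \<in> Poly_Mapping.keys (h u i) \<Longrightarrow> ?size v + size (M i) \<le> ?size u"
    unfolding choice_iff by blast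
  let ?c = "\<lambda>u. const (Poly_Mapping.lookup c u) :: ('n, 'a) mpoly"
  define R where "R = (\<Sum>u\<in>Poly_Mapping.keys c. ?c u * r u)"
  define H where "H i = (\<Sum>u\<in>Poly_Mapping.keys c. ?c u * h u i)" for i
  have keysR: "\<exists>u\<in>Poly_Mapping.keys c. v \<in> Poly_Mapping.keys (r u)"
    if "v \<in> Poly_Mapping.keys R" for v
    using that keys_sum_subset[of "\<lambda>u. ?c u * r u"] keys_const_mult_subset
    unfolding R_def by blast
  have keysH: "\<exists>u\<in>Poly_Mapping.keys c. v \<in> Poly_Mapping.keys (h u i)"
    if "v \<in> Poly_Mapping.keys (H i)" for v i
    using that keys_sum_subset[of "\<lambda>u. ?c u * h u i"] keys_const_mult_subset
    unfolding H_def by blast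
  show ?thesis
  proof
    have "f = R + (\<Sum>u\<in>Poly_Mapping.keys c. \<Sum>i\<in>UNIV. ?c u * h u i * grid_poly M i)"
      by (simp add: c newton_sum_def rh R_def distrib_left sum.distrib sum_distrib_left mult.assoc)
    also have "\<dots> = R + (\<Sum>i\<in>UNIV. H i * grid_poly M i)"
      by (subst sum.swap) (simp add: H_def sum_distrib_right)
    finally show "f = R + (\<Sum>i\<in>UNIV. H i * grid_poly M i)" .
    show "degree_in i R < ereal (real (size (M i)))" for i
      using keysR r by (auto simp: degree_in_less_iff)
    show "total_degree (H i) \<le> total_degree f - ereal (real (size (M i)))" for i
    proof (rule total_degree_le_diff)
      fix v
      assume "v \<in> Poly_Mapping.keys (H i)"
      then obtain u where u: "u \<in> Poly_Mapping.keys c" "v \<in> Poly_Mapping.keys (h u i)"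
        using keysH by blast
      from dom[OF u(1)] obtain u' where u': "u' \<in> Poly_Mapping.keys f"
        "\<And>i. Poly_Mapping.lookup u i \<le> Poly_Mapping.lookup u' i" by blast
      have "?size u \<le> ?size u'" by (intro sum_mono u'(2))
      with h[OF u(2)] u'(1)
      show "\<exists>u\<in>Poly_Mapping.keys f. ?size v + size (M i) \<le> ?size u"
        using order_trans by blast
    qed
  qed
qed

theorem theorem1:
  fixes M :: "'n::finite \<Rightarrow> 'a::field multiset"
  assumes "\<And>i. M i \<noteq> {#}"
  shows "ideal_generated (range (grid_poly M)) = grid_ideal M \<and>
    (\<forall>f :: ('n, 'a) mpoly. \<exists>!r. \<exists>h :: 'n \<Rightarrow> ('n, 'a) mpoly.
      (\<forall>i. total_degree (h i) \<le> total_degree f - ereal (real (size (M i)))) \<and>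
      (\<forall>i. degree_in i r < ereal (real (size (M i)))) \<and>
      f = r + (\<Sum>i\<in>UNIV. h i * grid_poly M i))"
proof -
  interpret module "(*) :: ('n, 'a) mpoly \<Rightarrow> _" by (rule module_times)
  let ?g = "grid_poly M"
  have sum_in_span: "(\<Sum>i\<in>UNIV. h i * ?g i) \<in> ideal_generated (range ?g)" for h
    by (intro span_sum span_scale span_base rangeI)
  have span_le: "ideal_generated (range ?g) \<subseteq> grid_ideal M"
    by (rule span_minimal) (auto intro: grid_poly_in_grid_ideal grid_ideal_subspace)
  have "grid_ideal M \<subseteq> ideal_generated (range ?g)"
  proof
    fix f
    assume f: "f \<in> grid_ideal M"
    obtain r h where rh: "f = r + (\<Sum>i\<in>UNIV. h i * ?g i)"
      "\<And>i. degree_in i r < ereal (real (size (M i)))"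
      using grid_division[of f M] by blast
    have "r = f - (\<Sum>i\<in>UNIV. h i * ?g i)" using rh(1) by simp
    then have "r \<in> grid_ideal M"
      using f sum_in_span span_le subspace_diff[OF grid_ideal_subspace] by blast
    then have "r = 0" using rh(2) by (rule reduced_in_grid_ideal_eq_0)
    with rh(1) sum_in_span show "f \<in> ideal_generated (range ?g)" by simp
  qed
  moreover have "\<exists>!r. \<exists>h :: 'n \<Rightarrow> ('n, 'a) mpoly.
      (\<forall>i. total_degree (h i) \<le> total_degree f - ereal (real (size (M i)))) \<and>
      (\<forall>i. degree_in i r < ereal (real (size (M i)))) \<and>
      f = r + (\<Sum>i\<in>UNIV. h i * ?g i)" (is "\<exists>!r. ?P r") for f :: "('n, 'a) mpoly"
  proof (rule ex_ex1I)
    show "\<exists>r. ?P r"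
      by (rule grid_division[of f M]) blast
  next
    fix r r'
    assume "?P r" "?P r'"
    then obtain h h' where h: "f = r + (\<Sum>i\<in>UNIV. h i * ?g i)" "f = r' + (\<Sum>i\<in>UNIV. h' i * ?g i)"
      and deg: "\<And>i. degree_in i r < ereal (real (size (M i)))"
        "\<And>i. degree_in i r' < ereal (real (size (M i)))"
      by blast
    have "r - r' = (\<Sum>i\<in>UNIV. (h' i - h i) * ?g i)"
      using h by (simp add: left_diff_distrib sum_subtractf algebra_simps)
    then have "r - r' \<in> grid_ideal M" using sum_in_span span_le by auto
    moreover have "degree_in i (r - r') < ereal (real (size (M i)))" for i
      using deg[of i] unfolding degree_in_less_iff
      by (auto simp: in_keys_iff lookup_minus)
    ultimately have "r - r' = 0" by (rule reduced_in_grid_ideal_eq_0)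
    then show "r = r'" by simp
  qed
  ultimately show ?thesis using span_le by blast
qed

end
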